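(* Let $K(a_{n,k})$ be a Köthe space, let $\beta$ be a non-negative increasing sequence tending to infinity, and let $\theta=(\theta_n)_{n\in\mathbb{N}_0}\in\Lambda_\infty(\beta)$. Assume that there exists $m\in\mathbb{N}$ such that for every $k\in\mathbb{N}$ there exists $C>0$ with $$e^{-k\beta_n}\le C\,a_{n,m}\qquad\text{for all }n\in\mathbb{N}.$$ Then the Hankel operator $H_\theta:K(a_{n,k})\to\Lambda_\infty(\beta)$ is compact.
   Context: $\mathbb{N}=\{1,2,\dots\}$, $\mathbb{N}_0=\mathbb{N}\cup\{0\}$. A Köthe matrix is a matrix $(a_{n,k})_{n,k\in\mathbb{N}}$ of non-negative numbers such that for each $n$ there is $k$ with $a_{n,k}>0$, and $a_{n,k}\le a_{n,k+1}$ for all $n,k$. The associated Köthe space is the Fréchet space $K(a_{n,k})=\{x=(x_n)_{n\in\mathbb{N}}:\ \|x\|_k:=\sum_{n=1}^\infty|x_n|a_{n,k}<\infty\ \text{for all }k\in\mathbb{N}\}$ with seminorms $\|\cdot\|_k$, $k\in\mathbb{N}$. For a non-negative increasing sequence $\beta=(\beta_n)_{n\in\mathbb{N}}$ with $\beta_n\to\infty$, the power series space of infinite type is $\Lambda_\infty(\beta)=K(e^{k\beta_n})$, i.e. $\|x\|_k=\sum_{n=1}^\infty|x_n|e^{k\beta_n}$. The sequence $e_n$ has $1$ in the $n$-th place and $0$ elsewhere. A sequence $\theta=(\theta_n)_{n\in\mathbb{N}_0}$ is identified with the sequence $(\theta_{n-1})_{n\in\mathbb{N}}=(\theta_0,\theta_1,\theta_2,\dots)$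 when it is said to belong to a sequence space. The Hankel operator $H_\theta$ from a Köthe space $E$ to a Köthe space $F$ is given by $H_\theta e_n=(\theta_{n-1},\theta_n,\theta_{n+1},\dots)=\sum_{j=1}^\infty\theta_{j+n-2}e_j$ for $n\in\mathbb{N}$ and $H_\theta x=\sum_{n=1}^\infty x_nH_\theta e_n$ for $x=(x_n)\in E$ (its existence as a map means that $H_\theta e_n\in F$ for all $n$ and the series converges in $F$ for every $x\in E$). A linear map $T:E\to F$ between Fréchet spaces is compact if $T(U)$ is precompact in $F$ for some neighborhood $U$ of zero in $E$. *)

theory Defs
  imports "HOL-Analysis.Analysis" "HOL-Library.Function_Algebras"
begin

text \<open>
  All index sets \<open>{1, 2, \<dots>}\<close> are shifted to start at 0: \<open>x n\<close>, \<open>\<beta> n\<close> and \<open>a n k\<close> stand for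
  \<open>x\<close>, \<open>\<beta>\<close> and \<open>a\<close> at the indices \<open>n + 1\<close> and \<open>k + 1\<close> of the usual notation.  A sequence
  \<open>\<theta>\<close> indexed from 0 is thereby literally identified with the shifted sequence indexed from 1.
  The scalars are of sort \<open>{real_normed_field, heine_borel}\<close>, so that the
  real and the complex spaces are covered simultaneously.
\<close>

definition kothe_matrix :: "(nat \<Rightarrow> nat \<Rightarrow> real) \<Rightarrow> bool" where
  "kothe_matrix a \<longleftrightarrow>
     (\<forall>n k. 0 \<le> a n k) \<and> (\<forall>n. \<exists>k. 0 < a n k) \<and> (\<forall>n k. a n k \<le> a n (Suc k))"

definition kothe_space :: "(nat \<Rightarrow> nat \<Rightarrow> real) \<Rightarrow> (nat \<Rightarrow> 'a::real_normed_field) set" where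
  "kothe_space a = {x. \<forall>k. summable (\<lambda>n. norm (x n) * a n k)}"

text \<open>Only meaningful for \<open>x \<in> kothe_space a\<close>.\<close>

definition kothe_seminorm ::
  "(nat \<Rightarrow> nat \<Rightarrow> real) \<Rightarrow> nat \<Rightarrow> (nat \<Rightarrow> 'a::real_normed_field) \<Rightarrow> real" where
  "kothe_seminorm a k x = (\<Sum>n. norm (x n) * a n k)"

definition kothe_ball ::
  "(nat \<Rightarrow> nat \<Rightarrow> real) \<Rightarrow> nat \<Rightarrow> (nat \<Rightarrow> 'a::real_normed_field) \<Rightarrow> real \<Rightarrow> (nat \<Rightarrow> 'a) set" where
  "kothe_ball a k x r = {y \<in> kothe_space a. kothe_seminorm a k (y - x) < r}"

definition kothe_topology ::
  "(nat \<Rightarrow> nat \<Rightarrow> real) \<Rightarrow> (nat \<Rightarrow> 'a::real_normed_field) topology" where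
  "kothe_topology a =
     topology_generated_by {kothe_ball a k x r | k x r. x \<in> kothe_space a \<and> 0 < r}"

lemma topspace_kothe_topology [simp]:
  "topspace (kothe_topology a :: (nat \<Rightarrow> 'a::real_normed_field) topology) = kothe_space a"
proof -
  have "kothe_seminorm a 0 (x - x) < 1" for x :: "nat \<Rightarrow> 'a"
    by (simp add: kothe_seminorm_def)
  then have "x \<in> kothe_ball a 0 x 1" if "x \<in> kothe_space a" for x :: "nat \<Rightarrow> 'a"
    using that unfolding kothe_ball_def by blast
  moreover have "(0::real) < 1"
    by simp
  ultimately have "\<Union>{kothe_ball a k x r | k x r. x \<in> kothe_space a \<and> 0 < r} =
      (kothe_space a :: (nat \<Rightarrow> 'a) set)"
    unfolding kothe_ball_def by blast
  then show ?thesis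
    unfolding kothe_topology_def topology_generated_by_topspace .
qed

definition power_series_matrix :: "(nat \<Rightarrow> real) \<Rightarrow> nat \<Rightarrow> nat \<Rightarrow> real" where
  "power_series_matrix \<beta> n k = exp (real (Suc k) * \<beta> n)"

definition seq_scale :: "'a::real_normed_field \<Rightarrow> (nat \<Rightarrow> 'a) \<Rightarrow> nat \<Rightarrow> 'a" where
  "seq_scale c x = (\<lambda>n. c * x n)"

text \<open>Precompactness (total boundedness) with respect to the translation-invariant uniformity of a
  topological vector space of sequences.\<close>

definition precompact_in ::
  "(nat \<Rightarrow> 'a::real_normed_field) topology \<Rightarrow> (nat \<Rightarrow> 'a) set \<Rightarrow> bool" where
  "precompact_in Y S \<longleftrightarrow> S \<subseteq> topspace Y \<and>
     (\<forall>V. openin Y V \<and> 0 \<in> V \<longrightarrow>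
        (\<exists>A. finite A \<and> A \<subseteq> topspace Y \<and> S \<subseteq> (\<Union>y\<in>A. (+) y ` V)))"

definition linear_between ::
  "(nat \<Rightarrow> 'a::real_normed_field) set \<Rightarrow> (nat \<Rightarrow> 'a) set \<Rightarrow> ((nat \<Rightarrow> 'a) \<Rightarrow> (nat \<Rightarrow> 'a)) \<Rightarrow> bool" where
  "linear_between E F T \<longleftrightarrow> T ` E \<subseteq> F \<and>
     (\<forall>x\<in>E. \<forall>y\<in>E. T (x + y) = T x + T y) \<and>
     (\<forall>c. \<forall>x\<in>E. T (seq_scale c x) = seq_scale c (T x))"

definition compact_linear_map ::
  "(nat \<Rightarrow> 'a::real_normed_field) topology \<Rightarrow> (nat \<Rightarrow> 'a) topology \<Rightarrow>
     ((nat \<Rightarrow> 'a) \<Rightarrow> (nat \<Rightarrow> 'a)) \<Rightarrow> bool" where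
  "compact_linear_map X Y T \<longleftrightarrow> linear_between (topspace X) (topspace Y) T \<and>
     (\<exists>U. openin X U \<and> 0 \<in> U \<and> precompact_in Y (T ` U))"

text \<open>The image of the unit vector at position \<open>n\<close>; the usual index \<open>j + n - 2\<close> becomes \<open>j + n\<close>.\<close>

definition hankel_column :: "(nat \<Rightarrow> 'a::real_normed_field) \<Rightarrow> nat \<Rightarrow> nat \<Rightarrow> 'a" where
  "hankel_column \<theta> n = (\<lambda>j. \<theta> (j + n))"

definition hankel_partial_sum ::
  "(nat \<Rightarrow> 'a::real_normed_field) \<Rightarrow> (nat \<Rightarrow> 'a) \<Rightarrow> nat \<Rightarrow> nat \<Rightarrow> 'a" where
  "hankel_partial_sum \<theta> x N = (\<Sum>n<N. seq_scale (x n) (hankel_column \<theta> n))"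

definition hankel_exists ::
  "(nat \<Rightarrow> nat \<Rightarrow> real) \<Rightarrow> (nat \<Rightarrow> nat \<Rightarrow> real) \<Rightarrow> (nat \<Rightarrow> 'a::real_normed_field) \<Rightarrow> bool" where
  "hankel_exists a b \<theta> \<longleftrightarrow>
     (\<forall>n. hankel_column \<theta> n \<in> kothe_space b) \<and>
     (\<forall>x \<in> kothe_space a. \<exists>y. limitin (kothe_topology b) (hankel_partial_sum \<theta> x) y sequentially)"

text \<open>The limit is taken in the topology of the target space \<open>K(b)\<close>.\<close>

definition hankel_operator ::
  "(nat \<Rightarrow> nat \<Rightarrow> real) \<Rightarrow> (nat \<Rightarrow> 'a::real_normed_field) \<Rightarrow> (nat \<Rightarrow> 'a) \<Rightarrow> (nat \<Rightarrow> 'a)" where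
  "hankel_operator b \<theta> x =
     (THE y. limitin (kothe_topology b) (hankel_partial_sum \<theta> x) y sequentially)"

end

theory Submission imports Defs begin

text \<open>
  Since \<open>\<beta>\<close> is increasing, \<open>k \<beta>\<^sub>j \<le> (k + 1) \<beta>\<^bsub>j + n\<^esub> - \<beta>\<^sub>n\<close>, so the columns satisfy
  \<open>\<parallel>H e\<^sub>n\<parallel>\<^sub>k \<le> exp (- \<beta>\<^sub>n) \<parallel>\<theta>\<parallel>\<^bsub>k + 1\<^esub> \<le> C\<^sub>k a\<^bsub>n,m\<^esub>\<close> with one and the same \<open>m\<close> for all \<open>k\<close>.
  Summing over the columns gives \<open>\<parallel>H x\<parallel>\<^sub>k \<le> C\<^sub>k \<parallel>x\<parallel>\<^sub>m\<close>, so \<open>H\<close> maps the unit ball of \<open>\<parallel>\<cdot>\<parallel>\<^sub>m\<close> to a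
  bounded set.  Bounded subsets of \<open>\<Lambda>\<^sub>\<infinity>(\<beta>)\<close> are precompact, because the tail of \<open>y\<close> from
  position \<open>N\<close> on has \<open>k\<close>-th seminorm at most \<open>exp (- \<beta>\<^sub>N) \<parallel>y\<parallel>\<^bsub>k + 1\<^esub>\<close>, and bounded sets in
  finitely many coordinates are totally bounded.
\<close>

section \<open>Absolute convergence\<close>

text \<open>The sort \<open>{real_normed_field, heine_borel}\<close> implies completeness but is not a subsort of
  \<open>banach\<close>, so the library facts on absolutely convergent series do not apply.\<close>

lemma summable_norm_cancel_complete:
  fixes f :: "nat \<Rightarrow> 'a::{real_normed_vector, complete_space}"
  assumes "summable (\<lambda>n. norm (f n))"
  shows "summable f"
proof -
  let ?S = "\<lambda>n. \<Sum>i<n. norm (f i)" and ?F = "\<lambda>n. \<Sum>i<n. f i"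
  \<comment> \<open>Between two indices the triangle inequality bounds the increment of
    \<open>?F\<close> by that of \<open>?S\<close>, so the Cauchy property passes from the sums of
    norms to the series itself.\<close>
  have *: "dist (?F p) (?F q) \<le> dist (?S p) (?S q)" if "p \<le> q" for p q
  proof -
    have "?F q - ?F p = sum f {p..<q}" "?S q - ?S p = (\<Sum>i=p..<q. norm (f i))"
      using that by (simp_all flip: sum_diff add: lessThan_minus_lessThan)
    then show ?thesis
      using norm_sum[of f "{p..<q}"]
      by (simp add: dist_norm norm_minus_commute[of "?F p"] abs_minus_commute[of "?S p"])
  qed
  have **: "dist (?F p) (?F q) \<le> dist (?S p) (?S q)" for p q
    using *[of p q] *[of q p] by (cases "p \<le> q") (simp_all add: dist_commute)
  have "Cauchy ?S"
    using assms by (simp add: summable_iff_convergent Cauchy_convergent_iff)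
  then have "Cauchy ?F"
    unfolding Cauchy_def using ** by (meson le_less_trans)
  then show ?thesis
    by (simp add: summable_iff_convergent Cauchy_convergent_iff)
qed

text \<open>The triangle inequality for finite sums, passed to the limit.\<close>

lemma norm_suminf_le_complete:
  fixes f :: "nat \<Rightarrow> 'a::{real_normed_vector, complete_space}"
  assumes "summable (\<lambda>n. norm (f n))"
  shows "norm (suminf f) \<le> (\<Sum>n. norm (f n))"
proof (rule LIMSEQ_le_const2)
  show "(\<lambda>N. norm (\<Sum>n<N. f n)) \<longlonglongrightarrow> norm (suminf f)"
    using summable_LIMSEQ[OF summable_norm_cancel_complete[OF assms]] by (rule tendsto_norm)
  have "norm (\<Sum>i<n. f i) \<le> (\<Sum>n. norm (f n))" for n
    using order_trans[OF norm_sum sum_le_suminf[OF assms]] by simp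
  then show "\<exists>N. \<forall>n\<ge>N. norm (\<Sum>i<n. f i) \<le> (\<Sum>n. norm (f n))"
    by blast
qed

lemma sum_seq_apply:
  fixes f :: "'i \<Rightarrow> 'b \<Rightarrow> 'a::comm_monoid_add"
  shows "(\<Sum>i\<in>A. f i) x = (\<Sum>i\<in>A. f i x)"
  by (induction A rule: infinite_finite_induct) auto

section \<open>The seminorms and the topology of a Koethe space\<close>

lemma kothe_matrix_nonneg: "kothe_matrix a \<Longrightarrow> 0 \<le> a n k"
  by (simp add: kothe_matrix_def)

lemma kothe_matrix_mono:
  assumes "kothe_matrix a" "k \<le> l"
  shows "a n k \<le> a n l"
  using assms lift_Suc_mono_le[of "a n" k l] by (simp add: kothe_matrix_def)

lemma kothe_space_summable:
  "x \<in> kothe_space a \<Longrightarrow> summable (\<lambda>n. norm (x n) * a n k)"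
  by (simp add: kothe_space_def)

lemma zero_in_kothe_space [simp]: "0 \<in> kothe_space a"
  by (simp add: kothe_space_def)

lemma kothe_seminorm_zero [simp]: "kothe_seminorm a k 0 = 0"
  by (simp add: kothe_seminorm_def)

lemma kothe_seminorm_minus_commute:
  "kothe_seminorm a k (x - y) = kothe_seminorm a k (y - x)"
  by (simp add: kothe_seminorm_def norm_minus_commute)

text \<open>Koethe spaces are solid. This covers negation as well as the truncation of a sequence to
  its tail.\<close>

lemma kothe_space_le:
  assumes "kothe_matrix a" "x \<in> kothe_space a" "\<And>n. norm (y n) \<le> norm (x n)"
  shows "y \<in> kothe_space a"
  unfolding kothe_space_def
proof (intro CollectI allI)
  fix k
  show "summable (\<lambda>n. norm (y n) * a n k)"
    using assms
    by (intro summable_comparison_test'[OF kothe_space_summable[OF assms(2), of k], of 0])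
      (simp add: kothe_matrix_nonneg mult_right_mono)
qed

lemma kothe_seminorm_nonneg:
  "kothe_matrix a \<Longrightarrow> x \<in> kothe_space a \<Longrightarrow> 0 \<le> kothe_seminorm a k x"
  unfolding kothe_seminorm_def
  by (intro suminf_nonneg kothe_space_summable) (simp_all add: kothe_matrix_nonneg)

lemma kothe_seminorm_mono:
  assumes "kothe_matrix a" "x \<in> kothe_space a" "k \<le> l"
  shows "kothe_seminorm a k x \<le> kothe_seminorm a l x"
  unfolding kothe_seminorm_def using assms
  by (intro suminf_le kothe_space_summable mult_left_mono kothe_matrix_mono) auto

text \<open>One term of a nonnegative series is at most its sum. Wherever \<open>a n k\<close> is
  positive, the \<open>k\<close>-th seminorm thus controls the \<open>n\<close>-th
  coordinate.\<close>

lemma norm_mult_le_kothe_seminorm: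
  assumes "kothe_matrix a" "x \<in> kothe_space a"
  shows "norm (x n) * a n k \<le> kothe_seminorm a k x"
  using sum_le_suminf[OF kothe_space_summable[OF assms(2)], of "{n}" k] assms(1)
  by (simp add: kothe_seminorm_def kothe_matrix_nonneg)

lemma
  assumes "kothe_matrix a" "x \<in> kothe_space a" "y \<in> kothe_space a"
  shows add_in_kothe_space: "x + y \<in> kothe_space a"
    and kothe_seminorm_triangle:
      "kothe_seminorm a k (x + y) \<le> kothe_seminorm a k x + kothe_seminorm a k y"
proof -
  have le: "norm ((x + y) n) * a n k \<le> norm (x n) * a n k + norm (y n) * a n k" for n k
    using assms(1) kothe_matrix_nonneg
    by (simp flip: distrib_right add: mult_right_mono norm_triangle_ineq)
  have sm: "summable (\<lambda>n. norm (x n) * a n k + norm (y n) * a n k)" for k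
    using assms by (intro summable_add kothe_space_summable)
  show *: "x + y \<in> kothe_space a"
    unfolding kothe_space_def
  proof (intro CollectI allI)
    fix k
    show "summable (\<lambda>n. norm ((x + y) n) * a n k)"
      using le assms(1)
      by (intro summable_comparison_test'[OF sm[of k], of 0]) (simp add: kothe_matrix_nonneg)
  qed
  show "kothe_seminorm a k (x + y) \<le> kothe_seminorm a k x + kothe_seminorm a k y"
    unfolding kothe_seminorm_def
    using suminf_le[OF le kothe_space_summable[OF *] sm]
      suminf_add[OF kothe_space_summable kothe_space_summable, OF assms(2,3)]
    by simp
qed

lemma diff_in_kothe_space:
  assumes "kothe_matrix a" "x \<in> kothe_space a" "y \<in> kothe_space a"
  shows "x - y \<in> kothe_space a"
proof -
  have "- y \<in> kothe_space a"
    using assms by (auto intro: kothe_space_le)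
  then show ?thesis
    using add_in_kothe_space[OF assms(1,2)] by fastforce
qed

lemma seq_scale_in_kothe_space:
  "x \<in> kothe_space a \<Longrightarrow> seq_scale c x \<in> kothe_space a"
  by (simp add: kothe_space_def seq_scale_def norm_mult mult.assoc summable_mult)

lemma sum_in_kothe_space:
  assumes "kothe_matrix a" "\<And>i. i \<in> I \<Longrightarrow> f i \<in> kothe_space a"
  shows "(\<Sum>i\<in>I. f i) \<in> kothe_space a"
  using assms(2)
  by (induction I rule: infinite_finite_induct) (simp_all add: add_in_kothe_space[OF assms(1)])

lemma kothe_seminorm_diff_triangle:
  assumes "kothe_matrix a" "x \<in> kothe_space a" "y \<in> kothe_space a" "z \<in> kothe_space a"
  shows "kothe_seminorm a k (x - z) \<le> kothe_seminorm a k (x - y) + kothe_seminorm a k (y - z)"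
  using kothe_seminorm_triangle[OF assms(1), of "x - y" "y - z"] assms
  by (simp add: diff_in_kothe_space)

section \<open>Neighbourhoods and sequential limits in the Koethe topology\<close>

lemma openin_kothe_ball:
  "x \<in> kothe_space a \<Longrightarrow> 0 < r \<Longrightarrow> openin (kothe_topology a) (kothe_ball a k x r)"
  unfolding kothe_topology_def openin_topology_generated_by_iff
  by (rule generate_topology_on.Basis) blast

lemma centre_in_kothe_ball: "x \<in> kothe_space a \<Longrightarrow> 0 < r \<Longrightarrow> x \<in> kothe_ball a k x r"
  by (simp add: kothe_ball_def)

text \<open>The topology is generated by the balls as a subbasis. Because the seminorms increase
  with \<open>k\<close>, a finite intersection of balls contains a ball about each of its points, so
  single balls form a neighbourhood base.\<close>

lemma openin_kothe_topology_imp_ball: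
  assumes a: "kothe_matrix a" and "openin (kothe_topology a) V" "x \<in> V"
  shows "\<exists>k r. 0 < r \<and> kothe_ball a k x r \<subseteq> V"
proof -
  have "generate_topology_on {kothe_ball a k x r | k x r. x \<in> kothe_space a \<and> 0 < r} V"
    using assms(2) unfolding kothe_topology_def openin_topology_generated_by_iff .
  then show ?thesis
    using \<open>x \<in> V\<close>
  proof (induction V)
    case Empty
    then show ?case by simp
  next
    case (Int V W)
    obtain k r l s where V: "0 < r" "kothe_ball a k x r \<subseteq> V" and W: "0 < s" "kothe_ball a l x s \<subseteq> W"
      using Int by auto
    have x: "x \<in> kothe_space a"
    proof -
      have "openin (kothe_topology a) V"
        unfolding kothe_topology_def openin_topology_generated_by_iff by (rule Int)
      then show ?thesis
        using openin_subset Int(5) by fastforce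
    qed
    \<comment> \<open>The larger index dominates both seminorms, and the smaller radius fits both
      balls.\<close>
    have "kothe_ball a (max k l) x (min r s) \<subseteq> kothe_ball a k x r \<inter> kothe_ball a l x s"
    proof
      fix y assume y: "y \<in> kothe_ball a (max k l) x (min r s)"
      then have yx: "y - x \<in> kothe_space a"
        using diff_in_kothe_space[OF a _ x] by (simp add: kothe_ball_def)
      show "y \<in> kothe_ball a k x r \<inter> kothe_ball a l x s"
        using y kothe_seminorm_mono[OF a yx, of k "max k l"] kothe_seminorm_mono[OF a yx, of l "max k l"]
        by (simp add: kothe_ball_def)
    qed
    then show ?case
      using V W by (intro exI[of _ "max k l"] exI[of _ "min r s"]) auto
  next
    case (UN \<V>)
    then show ?case by (meson Union_iff Union_upper subset_trans)
  next
    case (Basis V)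
    then obtain k c r where V: "V = kothe_ball a k c r" "c \<in> kothe_space a" "0 < r"
      by blast
    \<comment> \<open>The room left between \<open>x\<close> and the boundary of the ball around
      \<open>c\<close>.\<close>
    define s where "s = r - kothe_seminorm a k (x - c)"
    have x: "x \<in> kothe_space a" "0 < s"
      using Basis(2) V by (auto simp: kothe_ball_def s_def)
    have "kothe_ball a k x s \<subseteq> V"
    proof
      fix y assume "y \<in> kothe_ball a k x s"
      then show "y \<in> V"
        using kothe_seminorm_diff_triangle[OF a _ x(1) V(2), of y k]
        by (simp add: kothe_ball_def V(1) s_def)
    qed
    then show ?case
      using x by blast
  qed
qed

text \<open>Openness of the balls gives one direction, the neighbourhood base of balls the
  other.\<close>

lemma limitin_kothe_topology_iff:
  assumes a: "kothe_matrix a" and f: "\<And>N. f N \<in> kothe_space a"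
  shows "limitin (kothe_topology a) f y sequentially \<longleftrightarrow>
    y \<in> kothe_space a \<and> (\<forall>k. (\<lambda>N. kothe_seminorm a k (f N - y)) \<longlonglongrightarrow> 0)"
proof (intro iffI conjI allI)
  assume L: "limitin (kothe_topology a) f y sequentially"
  then show y: "y \<in> kothe_space a"
    using limitin_topspace by fastforce
  fix k
  show "(\<lambda>N. kothe_seminorm a k (f N - y)) \<longlonglongrightarrow> 0"
  proof (rule order_tendstoI)
    fix e :: real assume "e < 0"
    then show "\<forall>\<^sub>F N in sequentially. e < kothe_seminorm a k (f N - y)"
      using kothe_seminorm_nonneg[OF a diff_in_kothe_space[OF a f y]]
      by (intro always_eventually allI) (meson less_le_trans)
  next
    fix e :: real assume "0 < e"
    then have "\<forall>\<^sub>F N in sequentially. f N \<in> kothe_ball a k y e"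
      using L openin_kothe_ball[OF y] centre_in_kothe_ball[OF y] by (simp add: limitin_def)
    then show "\<forall>\<^sub>F N in sequentially. kothe_seminorm a k (f N - y) < e"
      by eventually_elim (simp add: kothe_ball_def)
  qed
next
  assume L: "y \<in> kothe_space a \<and> (\<forall>k. (\<lambda>N. kothe_seminorm a k (f N - y)) \<longlonglongrightarrow> 0)"
  show "limitin (kothe_topology a) f y sequentially"
    unfolding limitin_def
  proof (intro conjI allI impI)
    fix V assume "openin (kothe_topology a) V \<and> y \<in> V"
    then obtain k r where V: "0 < r" "kothe_ball a k y r \<subseteq> V"
      using openin_kothe_topology_imp_ball[OF a] by blast
    have "\<forall>\<^sub>F N in sequentially. kothe_seminorm a k (f N - y) < r"
      using order_tendstoD(2)[OF spec[OF conjunct2[OF L]] V(1)] .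
    then show "\<forall>\<^sub>F N in sequentially. f N \<in> V"
      by eventually_elim (use V(2) f in \<open>auto simp: kothe_ball_def\<close>)
  qed (use L in simp)
qed

text \<open>Every coordinate has a positive weight for some \<open>k\<close>, so a limit in the
  Koethe topology is also a coordinatewise limit. Uniqueness gives meaning to the definite
  description in \<open>hankel_operator\<close>.\<close>

lemma limitin_kothe_topology_unique:
  assumes a: "kothe_matrix a" and f: "\<And>N. f N \<in> kothe_space a"
    and y: "limitin (kothe_topology a) f y sequentially"
    and z: "limitin (kothe_topology a) f z sequentially"
  shows "y = z"
proof
  fix n
  obtain k where k: "0 < a n k"
    using a unfolding kothe_matrix_def by blast
  have "(\<lambda>N. f N n) \<longlonglongrightarrow> w n" if "limitin (kothe_topology a) f w sequentially" for w
  proof -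
    have w: "w \<in> kothe_space a" "(\<lambda>N. kothe_seminorm a k (f N - w)) \<longlonglongrightarrow> 0"
      using that unfolding limitin_kothe_topology_iff[OF a f] by auto
    have "norm (f N n - w n) \<le> kothe_seminorm a k (f N - w) / a n k" for N
      using norm_mult_le_kothe_seminorm[OF a diff_in_kothe_space[OF a f w(1)], of N n k] k
      by (simp add: field_simps)
    then have "(\<lambda>N. f N n - w n) \<longlonglongrightarrow> 0"
      by (intro Lim_null_comparison[OF always_eventually tendsto_divide_zero[OF w(2)]] allI)
    then show ?thesis
      by (simp add: LIM_zero_iff)
  qed
  from this[OF y] this[OF z] show "y n = z n"
    by (rule LIMSEQ_unique)
qed

section \<open>Hankel operators with dominated columns\<close>

text \<open>The index \<open>m\<close> in \<open>dom\<close> does not depend on \<open>k\<close>, so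
  every seminorm of the column series is dominated by a multiple of the one series for
  \<open>kothe_seminorm a m x\<close>.\<close>

lemma hankel_column_dominated:
  fixes \<theta> x :: "nat \<Rightarrow> 'a::{real_normed_field, heine_borel}"
  assumes a: "kothe_matrix a" and b: "kothe_matrix b"
    and col: "\<And>n. hankel_column \<theta> n \<in> kothe_space b"
    and dom: "\<And>k. \<exists>C\<ge>0. \<forall>n. kothe_seminorm b k (hankel_column \<theta> n) \<le> C * a n m"
    and x: "x \<in> kothe_space a"
  shows summable_hankel_row: "summable (\<lambda>n. norm (x n * \<theta> (j + n)))"
    and hankel_image_in_kothe_space: "(\<lambda>j. \<Sum>n. x n * \<theta> (j + n)) \<in> kothe_space b"
    and kothe_seminorm_hankel_image_le:
      "(\<And>n. kothe_seminorm b k (hankel_column \<theta> n) \<le> C * a n m) \<Longrightarrow>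
        kothe_seminorm b k (\<lambda>j. \<Sum>n. x n * \<theta> (j + n)) \<le> C * kothe_seminorm a m x"
proof -
  let ?T = "\<lambda>j. \<Sum>n. x n * \<theta> (j + n)"
  have xm: "summable (\<lambda>n. norm (x n) * (C * a n m))" for C
    using summable_mult[OF kothe_space_summable[OF x, of m], of C] by (simp add: ac_simps)
  have row: "summable (\<lambda>n. norm (x n * \<theta> (j + n)))" for j
  proof -
    \<comment> \<open>A positive weight in row \<open>j\<close> lets the bound on the whole column
      be divided down to its single entry \<open>\<theta> (j + n)\<close>.\<close>
    obtain k where k: "0 < b j k"
      using b unfolding kothe_matrix_def by blast
    obtain C where C: "\<And>n. kothe_seminorm b k (hankel_column \<theta> n) \<le> C * a n m"
      using dom by blast
    have le: "norm (\<theta> (j + n)) \<le> C / b j k * a n m" for n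
      using order_trans[OF norm_mult_le_kothe_seminorm[OF b col, of n j k] C] k
      by (simp add: hankel_column_def field_simps)
    have "norm (norm (x n * \<theta> (j + n))) \<le> norm (x n) * (C / b j k * a n m)" for n
      unfolding real_norm_def abs_norm_cancel unfolding norm_mult by (rule mult_left_mono[OF le norm_ge_zero])
    then show ?thesis
      by (rule summable_comparison_test'[OF xm])
  qed
  then show "summable (\<lambda>n. norm (x n * \<theta> (j + n)))" .
  \<comment> \<open>With finitely many rows, the exchange with the series over \<open>n\<close> is
    just additivity of convergent series. Boundedness in \<open>J\<close> then gives both
    summability and the seminorm estimate.\<close>
  have bound: "(\<Sum>j<J. norm (?T j) * b j k) \<le> C * kothe_seminorm a m x"
    if C: "\<And>n. kothe_seminorm b k (hankel_column \<theta> n) \<le> C * a n m" for J k C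
  proof -
    have "(\<Sum>j<J. norm (?T j) * b j k) \<le> (\<Sum>j<J. (\<Sum>n. norm (x n * \<theta> (j + n))) * b j k)"
      by (intro sum_mono mult_right_mono norm_suminf_le_complete[OF row] kothe_matrix_nonneg[OF b])
    also have "\<dots> = (\<Sum>j<J. \<Sum>n. norm (x n * \<theta> (j + n)) * b j k)"
      by (simp only: suminf_mult2[OF row])
    also have "\<dots> = (\<Sum>n. \<Sum>j<J. norm (x n * \<theta> (j + n)) * b j k)"
      by (rule suminf_sum[OF summable_mult2[OF row], symmetric])
    also have "\<dots> \<le> (\<Sum>n. norm (x n) * (C * a n m))"
    proof (rule suminf_le[OF _ summable_sum[OF summable_mult2[OF row]] xm])
      fix n
      have "(\<Sum>j<J. norm (\<theta> (j + n)) * b j k) \<le> kothe_seminorm b k (hankel_column \<theta> n)"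
        using sum_le_suminf[OF kothe_space_summable[OF col[of n], of k], of "{..<J}"] b
        by (simp add: kothe_seminorm_def hankel_column_def kothe_matrix_nonneg)
      also note C
      finally have "norm (x n) * (\<Sum>j<J. norm (\<theta> (j + n)) * b j k) \<le> norm (x n) * (C * a n m)"
        by (rule mult_left_mono) simp
      then show "(\<Sum>j<J. norm (x n * \<theta> (j + n)) * b j k) \<le> norm (x n) * (C * a n m)"
        by (simp only: sum_distrib_left norm_mult mult.assoc)
    qed
    also have "\<dots> = C * kothe_seminorm a m x"
      unfolding kothe_seminorm_def
      using suminf_mult[OF kothe_space_summable[OF x, of m], of C] by (simp add: ac_simps)
    finally show ?thesis .
  qed
  have sm: "summable (\<lambda>j. norm (?T j) * b j k)" for k
  proof -
    obtain C where C: "\<And>n. kothe_seminorm b k (hankel_column \<theta> n) \<le> C * a n m"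
      using dom by blast
    show ?thesis
    proof (rule summableI_nonneg_bounded)
      show "(\<Sum>j<J. norm (?T j) * b j k) \<le> C * kothe_seminorm a m x" for J
        using C by (rule bound)
    qed (simp add: kothe_matrix_nonneg[OF b])
  qed
  then show "?T \<in> kothe_space b"
    by (simp add: kothe_space_def)
  show "kothe_seminorm b k ?T \<le> C * kothe_seminorm a m x"
    if "\<And>n. kothe_seminorm b k (hankel_column \<theta> n) \<le> C * a n m"
    unfolding kothe_seminorm_def[of b] using bound[OF that] by (intro suminf_le_const sm)
qed

lemma hankel_partial_sum_in_kothe_space:
  assumes "kothe_matrix b" "\<And>n. hankel_column \<theta> n \<in> kothe_space b"
  shows "hankel_partial_sum \<theta> x N \<in> kothe_space b"
  unfolding hankel_partial_sum_def
  using assms by (intro sum_in_kothe_space seq_scale_in_kothe_space)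

text \<open>The error after \<open>N\<close> columns is the Hankel image of the tail of
  \<open>x\<close> from \<open>N\<close> on. The operator bound therefore reduces convergence to
  that of the tails in the \<open>m\<close>-th seminorm.\<close>

lemma limitin_hankel_partial_sum:
  fixes \<theta> x :: "nat \<Rightarrow> 'a::{real_normed_field, heine_borel}"
  assumes a: "kothe_matrix a" and b: "kothe_matrix b"
    and col: "\<And>n. hankel_column \<theta> n \<in> kothe_space b"
    and dom: "\<And>k. \<exists>C\<ge>0. \<forall>n. kothe_seminorm b k (hankel_column \<theta> n) \<le> C * a n m"
    and x: "x \<in> kothe_space a"
  shows "limitin (kothe_topology b) (hankel_partial_sum \<theta> x) (\<lambda>j. \<Sum>n. x n * \<theta> (j + n)) sequentially"
  unfolding limitin_kothe_topology_iff[OF b hankel_partial_sum_in_kothe_space[OF b col]]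
proof (intro conjI allI hankel_image_in_kothe_space[OF a b col dom x])
  fix k
  let ?T = "\<lambda>x j. \<Sum>n. x n * \<theta> (j + n)"
  define t where "t N = (\<lambda>n. if n < N then 0 else x n)" for N
  have t: "t N \<in> kothe_space a" for N
    using x by (rule kothe_space_le[OF a]) (simp add: t_def)
  have eq: "?T x - hankel_partial_sum \<theta> x N = ?T (t N)" for N
  proof
    fix j
    \<comment> \<open>The first \<open>N\<close> terms padded with zeros, so that removing them is a
      difference of two convergent series.\<close>
    let ?p = "\<lambda>n. if n \<in> {..<N} then x n * \<theta> (j + n) else 0"
    have p: "?p sums (\<Sum>n<N. x n * \<theta> (j + n))"
      by (rule sums_If_finite_set) simp
    have sm: "summable (\<lambda>n. x n * \<theta> (j + n))"
      by (rule summable_norm_cancel_complete[OF summable_hankel_row[OF a b col dom x]])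
    have "(\<lambda>n. x n * \<theta> (j + n) - ?p n) sums (?T x j - (\<Sum>n<N. x n * \<theta> (j + n)))"
      using sums_diff[OF summable_sums[OF sm] p] .
    moreover have "(\<lambda>n. x n * \<theta> (j + n) - ?p n) = (\<lambda>n. t N n * \<theta> (j + n))"
      by (auto simp: t_def)
    ultimately have "?T x j - (\<Sum>n<N. x n * \<theta> (j + n)) = ?T (t N) j"
      by (simp add: sums_iff)
    then show "(?T x - hankel_partial_sum \<theta> x N) j = ?T (t N) j"
      by (simp add: hankel_partial_sum_def seq_scale_def hankel_column_def sum_seq_apply)
  qed
  have tail: "(\<lambda>N. kothe_seminorm a m (t N)) \<longlonglongrightarrow> 0"
  proof -
    have xm: "summable (\<lambda>n. norm (x n) * a n m)"
      using x by (rule kothe_space_summable)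
    have "kothe_seminorm a m (t N) = kothe_seminorm a m x - (\<Sum>n<N. norm (x n) * a n m)" for N
    proof -
      let ?p = "\<lambda>n. if n \<in> {..<N} then norm (x n) * a n m else 0"
      have "(\<lambda>n. norm (x n) * a n m - ?p n) sums
          (kothe_seminorm a m x - (\<Sum>n<N. norm (x n) * a n m))"
        unfolding kothe_seminorm_def
        by (intro sums_diff summable_sums xm sums_If_finite_set) simp
      moreover have "(\<lambda>n. norm (x n) * a n m - ?p n) = (\<lambda>n. norm (t N n) * a n m)"
        by (auto simp: t_def)
      ultimately show ?thesis
        by (simp add: kothe_seminorm_def sums_iff)
    qed
    then show ?thesis
      using tendsto_diff[OF tendsto_const summable_LIMSEQ[OF xm], of "kothe_seminorm a m x"]
      by (simp add: kothe_seminorm_def)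
  qed
  obtain C where C: "\<And>n. kothe_seminorm b k (hankel_column \<theta> n) \<le> C * a n m"
    using dom by blast
  have "kothe_seminorm b k (hankel_partial_sum \<theta> x N - ?T x) \<le> C * kothe_seminorm a m (t N)" for N
    unfolding kothe_seminorm_minus_commute[of b k "hankel_partial_sum \<theta> x N"] eq
    by (rule kothe_seminorm_hankel_image_le[OF a b col dom t C])
  moreover have "0 \<le> kothe_seminorm b k (hankel_partial_sum \<theta> x N - ?T x)" for N
    by (intro kothe_seminorm_nonneg diff_in_kothe_space b hankel_partial_sum_in_kothe_space col
        hankel_image_in_kothe_space[OF a b col dom x])
  ultimately show "(\<lambda>N. kothe_seminorm b k (hankel_partial_sum \<theta> x N - ?T x)) \<longlonglongrightarrow> 0"
    by (intro tendsto_sandwich[OF _ _ tendsto_const tendsto_mult_right_zero[OF tail, of C]]) simp_all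
qed

lemma hankel_operator_eq:
  fixes \<theta> x :: "nat \<Rightarrow> 'a::{real_normed_field, heine_borel}"
  assumes a: "kothe_matrix a" and b: "kothe_matrix b"
    and col: "\<And>n. hankel_column \<theta> n \<in> kothe_space b"
    and dom: "\<And>k. \<exists>C\<ge>0. \<forall>n. kothe_seminorm b k (hankel_column \<theta> n) \<le> C * a n m"
    and x: "x \<in> kothe_space a"
  shows "hankel_operator b \<theta> x = (\<lambda>j. \<Sum>n. x n * \<theta> (j + n))"
  unfolding hankel_operator_def
proof (rule the_equality)
  show *: "limitin (kothe_topology b) (hankel_partial_sum \<theta> x) (\<lambda>j. \<Sum>n. x n * \<theta> (j + n)) sequentially"
    by (rule limitin_hankel_partial_sum[OF a b col dom x])
  show "y = (\<lambda>j. \<Sum>n. x n * \<theta> (j + n))"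
    if "limitin (kothe_topology b) (hankel_partial_sum \<theta> x) y sequentially" for y
    using limitin_kothe_topology_unique[OF b hankel_partial_sum_in_kothe_space[OF b col] that *] .
qed

text \<open>Once the operator is given by row series, linearity is that of convergent series in each
  coordinate.\<close>

lemma linear_between_hankel_operator:
  fixes \<theta> :: "nat \<Rightarrow> 'a::{real_normed_field, heine_borel}"
  assumes a: "kothe_matrix a" and b: "kothe_matrix b"
    and col: "\<And>n. hankel_column \<theta> n \<in> kothe_space b"
    and dom: "\<And>k. \<exists>C\<ge>0. \<forall>n. kothe_seminorm b k (hankel_column \<theta> n) \<le> C * a n m"
  shows "linear_between (kothe_space a) (kothe_space b) (hankel_operator b \<theta>)"
proof -
  note eq = hankel_operator_eq[OF a b col dom]
  have row: "summable (\<lambda>n. x n * \<theta> (j + n))" if "x \<in> kothe_space a" for x :: "nat \<Rightarrow> 'a" and j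
    by (rule summable_norm_cancel_complete[OF summable_hankel_row[OF a b col dom that]])
  show ?thesis
    unfolding linear_between_def
  proof (intro conjI ballI allI image_subsetI)
    fix x :: "nat \<Rightarrow> 'a" assume x: "x \<in> kothe_space a"
    show "hankel_operator b \<theta> x \<in> kothe_space b"
      unfolding eq[OF x] by (rule hankel_image_in_kothe_space[OF a b col dom x])
    fix c
    show "hankel_operator b \<theta> (seq_scale c x) = seq_scale c (hankel_operator b \<theta> x)"
      unfolding eq[OF x] eq[OF seq_scale_in_kothe_space[OF x]]
      by (rule ext) (simp add: seq_scale_def mult.assoc suminf_mult[OF row[OF x]])
  next
    fix x y :: "nat \<Rightarrow> 'a" assume x: "x \<in> kothe_space a" and y: "y \<in> kothe_space a"
    show "hankel_operator b \<theta> (x + y) = hankel_operator b \<theta> x + hankel_operator b \<theta> y"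
      unfolding eq[OF x] eq[OF y] eq[OF add_in_kothe_space[OF a x y]]
      by (rule ext) (simp add: distrib_right suminf_add[OF row[OF x] row[OF y]])
  qed
qed

section \<open>Power series spaces of infinite type\<close>

lemma kothe_matrix_power_series_matrix:
  assumes "\<And>n. 0 \<le> \<beta> n"
  shows "kothe_matrix (power_series_matrix \<beta>)"
  using assms by (auto simp: kothe_matrix_def power_series_matrix_def mult_right_mono)

text \<open>The approximants take values in a finite net \<open>D\<close> of scalars below
  \<open>N\<close> and vanish from \<open>N\<close> on. Each of the two errors gets half of the
  radius \<open>r\<close>.\<close>

lemma precompact_in_power_series_space:
  fixes S :: "(nat \<Rightarrow> 'a::{real_normed_field, heine_borel}) set"
  assumes \<beta>: "\<And>n. 0 \<le> \<beta> n" and inc: "incseq \<beta>" and lim: "filterlim \<beta> at_top sequentially"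
    and S: "S \<subseteq> kothe_space (power_series_matrix \<beta>)"
    and bdd: "\<And>k. \<exists>M. \<forall>y\<in>S. kothe_seminorm (power_series_matrix \<beta>) k y \<le> M"
  shows "precompact_in (kothe_topology (power_series_matrix \<beta>)) S"
proof -
  let ?b = "power_series_matrix \<beta>"
  have b: "kothe_matrix ?b"
    by (rule kothe_matrix_power_series_matrix[OF \<beta>])
  have "\<exists>A. finite A \<and> A \<subseteq> kothe_space ?b \<and> S \<subseteq> (\<Union>y\<in>A. (+) y ` V)"
    if V: "openin (kothe_topology ?b) V" "0 \<in> V" for V :: "(nat \<Rightarrow> 'a) set"
  proof -
    obtain k r where r: "0 < r" "kothe_ball ?b k 0 r \<subseteq> V"
      using openin_kothe_topology_imp_ball[OF b V] by blast
    \<comment> \<open>The weights of index 0 are \<open>exp (\<beta> n)\<close>, hence at least 1,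
      so \<open>M0\<close> bounds every coordinate of every point of \<open>S\<close>.\<close>
    obtain M0 where M0: "\<And>y. y \<in> S \<Longrightarrow> kothe_seminorm ?b 0 y \<le> M0"
      using bdd by blast
    obtain M1 where M1: "\<And>y. y \<in> S \<Longrightarrow> kothe_seminorm ?b (Suc k) y \<le> M1"
      using bdd by blast
    \<comment> \<open>The maximum with 1 makes \<open>M\<close> positive, as the division and the
      logarithm below require.\<close>
    define M where "M = max M1 1"
    have M: "0 < M" "\<And>y. y \<in> S \<Longrightarrow> kothe_seminorm ?b (Suc k) y \<le> M"
      using M1 by (auto simp: M_def le_max_iff_disj)
    obtain N where N: "exp (- \<beta> N) * M < r / 2"
    proof -
      obtain N where "- ln (r / (2 * M)) < \<beta> N"
        using lim by (auto simp: filterlim_at_top_dense eventually_sequentially)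
      then have "exp (- \<beta> N) < exp (ln (r / (2 * M)))"
        by simp
      also have "\<dots> = r / (2 * M)"
        using r M(1) by simp
      finally have "exp (- \<beta> N) < r / (2 * M)" .
      then show ?thesis
        using M(1) by (intro that[of N]) (simp add: field_simps)
    qed
    \<comment> \<open>Adding 1 keeps \<open>B\<close> positive even for \<open>N = 0\<close>. A
      coordinatewise error below \<open>e = r / (2 * B)\<close> then costs at most
      \<open>r / 2\<close> on the first \<open>N\<close> places.\<close>
    define B where "B = (\<Sum>n<N. ?b n k) + 1"
    have B: "0 < B"
      unfolding B_def by (intro add_nonneg_pos sum_nonneg) (auto intro: kothe_matrix_nonneg[OF b])
    define e where "e = r / (2 * B)"
    have e: "0 < e"
      using r B by (simp add: e_def)
    \<comment> \<open>The scalars have the Heine-Borel property, so closed balls are compact and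
      hence totally bounded.\<close>
    have "\<forall>e>0. \<exists>D. finite D \<and> cball (0 :: 'a) M0 \<subseteq> (\<Union>d\<in>D. ball d e)"
      using compact_cball[of "0 :: 'a" M0] unfolding compact_eq_totally_bounded by (rule conjunct2)
    then obtain D :: "'a set" where D: "finite D" "cball 0 M0 \<subseteq> (\<Union>d\<in>D. ball d e)"
      using e by metis
    define A :: "(nat \<Rightarrow> 'a) set"
      where "A = (\<lambda>f n. if n < N then f n else 0) ` ({..<N} \<rightarrow>\<^sub>E D)"
    have finite_A: "finite A"
      unfolding A_def using D(1) by (intro finite_imageI finite_PiE) auto
    have A: "A \<subseteq> kothe_space ?b"
    proof
      fix y assume "y \<in> A"
      then obtain f where "y = (\<lambda>n. if n < N then f n else 0)"
        unfolding A_def by blast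
      then have "norm (y n) * ?b n k = 0" if "n \<notin> {..<N}" for n k
        using that by simp
      then have "summable (\<lambda>n. norm (y n) * ?b n k)" for k
        by (rule summable_finite[OF finite_lessThan])
      then show "y \<in> kothe_space ?b"
        by (simp add: kothe_space_def)
    qed
    have cover: "\<exists>y\<in>A. s \<in> (+) y ` V" if s: "s \<in> S" for s
    proof -
      have sb: "s \<in> kothe_space ?b"
        using s S by blast
      have "norm (s n) \<le> M0" for n
      proof -
        have "norm (s n) * 1 \<le> norm (s n) * ?b n 0"
          using \<beta> by (intro mult_left_mono) (auto simp: power_series_matrix_def)
        also have "\<dots> \<le> kothe_seminorm ?b 0 s"
          by (rule norm_mult_le_kothe_seminorm[OF b sb])
        finally show ?thesis
          using M0[OF s] by simp
      qed
      then have "\<forall>n. \<exists>d\<in>D. dist d (s n) < e"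
        using D(2) by (simp add: subset_eq)
      then obtain d where d: "\<And>n. d n \<in> D" "\<And>n. dist (d n) (s n) < e"
        by metis
      define y where "y n = (if n < N then d n else 0)" for n
      \<comment> \<open>The functions behind \<open>A\<close> are extensional on
        \<open>{..<N}\<close>, so \<open>d\<close> is restricted before it can serve as a
        witness.\<close>
      have "y = (\<lambda>n. if n < N then restrict d {..<N} n else 0)"
        by (auto simp: y_def)
      then have y: "y \<in> A"
        unfolding A_def using d(1) by (intro image_eqI[where x = "restrict d {..<N}"]) auto
      have sy: "s - y \<in> kothe_space ?b"
        using diff_in_kothe_space[OF b sb] y A by blast
      \<comment> \<open>\<open>?h\<close> majorizes the error below \<open>N\<close>, and the damped
        terms of \<open>s\<close> majorize it from \<open>N\<close> on. The latter are nonnegative,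
        so they may be added at every index.\<close>
      let ?h = "\<lambda>n. if n \<in> {..<N} then e * ?b n k else 0"
      have h: "?h sums (\<Sum>n<N. e * ?b n k)"
        by (rule sums_If_finite_set) simp
      have g: "(\<lambda>n. exp (- \<beta> N) * (norm (s n) * ?b n (Suc k))) sums
          (exp (- \<beta> N) * kothe_seminorm ?b (Suc k) s)"
        unfolding kothe_seminorm_def by (intro sums_mult summable_sums kothe_space_summable sb)
      have le: "norm ((s - y) n) * ?b n k \<le> ?h n + exp (- \<beta> N) * (norm (s n) * ?b n (Suc k))" for n
      proof (cases "n < N")
        case True
        have "norm (s n - d n) * ?b n k \<le> e * ?b n k"
          using d(2)[of n] kothe_matrix_nonneg[OF b]
          by (intro mult_right_mono) (auto simp: dist_norm norm_minus_commute)
        moreover have "0 \<le> exp (- \<beta> N) * (norm (s n) * ?b n (Suc k))"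
          using kothe_matrix_nonneg[OF b] by simp
        ultimately show ?thesis
          using True by (simp add: y_def)
      next
        case False
        then have "\<beta> N \<le> \<beta> n"
          using inc by (simp add: incseq_def)
        \<comment> \<open>Raising the index by one multiplies the weight by
          \<open>exp (\<beta> n)\<close>, which is at least \<open>exp (\<beta> N)\<close>.\<close>
        then have "?b n k \<le> exp (- \<beta> N) * ?b n (Suc k)"
          by (simp add: power_series_matrix_def algebra_simps flip: exp_add)
        then have "norm (s n) * ?b n k \<le> norm (s n) * (exp (- \<beta> N) * ?b n (Suc k))"
          by (rule mult_left_mono) simp
        then show ?thesis
          using False by (simp add: y_def mult.left_commute)
      qed
      have "kothe_seminorm ?b k (s - y) \<le>
          (\<Sum>n<N. e * ?b n k) + exp (- \<beta> N) * kothe_seminorm ?b (Suc k) s"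
        unfolding kothe_seminorm_def[of _ k]
        using suminf_le[OF le kothe_space_summable[OF sy] sums_summable[OF sums_add[OF h g]]]
          sums_unique[OF sums_add[OF h g]] by simp
      also have "\<dots> \<le> e * B + exp (- \<beta> N) * M"
        using M(2)[OF s] e
        by (intro add_mono mult_left_mono) (auto simp: B_def distrib_left simp flip: sum_distrib_left)
      also have "\<dots> < r"
        using N B by (simp add: e_def)
      finally have "s - y \<in> V"
        using sy r(2) by (auto simp: kothe_ball_def)
      then show ?thesis
        using y by (intro bexI[of _ y] image_eqI[of _ _ "s - y"]) simp_all
    qed
    have "S \<subseteq> (\<Union>y\<in>A. (+) y ` V)"
      by (rule subsetI, rule UN_iff[THEN iffD2], rule cover)
    with finite_A A show ?thesis
      by (intro exI[of _ A] conjI)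
  qed
  then show ?thesis
    unfolding precompact_in_def topspace_kothe_topology using S by (intro conjI allI impI) simp_all
qed

text \<open>The shift by \<open>n\<close> moves each entry to a place of no larger weight. The extra
  unit of exponent in the index \<open>Suc k\<close> is traded for the factor
  \<open>exp (- \<beta> n)\<close>.\<close>

lemma hankel_column_power_series:
  assumes \<beta>: "\<And>n. 0 \<le> \<beta> n" and inc: "incseq \<beta>"
    and \<theta>: "\<theta> \<in> kothe_space (power_series_matrix \<beta>)"
  shows hankel_column_in_power_series_space:
      "hankel_column \<theta> n \<in> kothe_space (power_series_matrix \<beta>)"
    and kothe_seminorm_hankel_column_le:
      "kothe_seminorm (power_series_matrix \<beta>) k (hankel_column \<theta> n) \<le>
        exp (- \<beta> n) * kothe_seminorm (power_series_matrix \<beta>) (Suc k) \<theta>"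
proof -
  let ?b = "power_series_matrix \<beta>"
  let ?c = "\<lambda>k j. exp (- \<beta> n) * (norm (\<theta> (j + n)) * ?b (j + n) (Suc k))"
  have shift: "summable (\<lambda>j. norm (\<theta> (j + n)) * ?b (j + n) k)" for k
    using kothe_space_summable[OF \<theta>] by (rule summable_ignore_initial_segment)
  have le: "norm (hankel_column \<theta> n j) * ?b j k \<le> ?c k j" for j k
  proof -
    \<comment> \<open>Both \<open>\<beta> j\<close> and \<open>\<beta> n\<close> are at most
      \<open>\<beta> (j + n)\<close>. The right-hand side is the exponent of the weight with index
      \<open>Suc k\<close> at \<open>j + n\<close>.\<close>
    have "real (Suc k) * \<beta> j + \<beta> n \<le>
        real (Suc k) * \<beta> (j + n) + \<beta> (j + n)"
      using inc by (intro add_mono mult_left_mono) (auto simp: incseq_def)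
    then have "?b j k \<le> exp (- \<beta> n) * ?b (j + n) (Suc k)"
      by (simp add: power_series_matrix_def algebra_simps flip: exp_add)
    then have "norm (\<theta> (j + n)) * ?b j k \<le>
        norm (\<theta> (j + n)) * (exp (- \<beta> n) * ?b (j + n) (Suc k))"
      by (rule mult_left_mono) simp
    then show ?thesis
      by (simp add: hankel_column_def mult.left_commute)
  qed
  show *: "hankel_column \<theta> n \<in> kothe_space ?b"
    unfolding kothe_space_def
  proof (intro CollectI allI)
    fix k
    show "summable (\<lambda>j. norm (hankel_column \<theta> n j) * ?b j k)"
      using le[of _ k] kothe_matrix_nonneg[OF kothe_matrix_power_series_matrix[OF \<beta>]]
      by (intro summable_comparison_test'[OF summable_mult[OF shift], of 0]) simp
  qed
  have "kothe_seminorm ?b k (hankel_column \<theta> n) \<le> (\<Sum>j. ?c k j)"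
    unfolding kothe_seminorm_def
    by (intro suminf_le le kothe_space_summable[OF *] summable_mult shift)
  also have "\<dots> = exp (- \<beta> n) * (\<Sum>j. norm (\<theta> (j + n)) * ?b (j + n) (Suc k))"
    by (rule suminf_mult[OF shift])
  \<comment> \<open>The shifted series is that of \<open>\<theta>\<close> without its first
    \<open>n\<close> terms, which are nonnegative.\<close>
  also have "\<dots> \<le> exp (- \<beta> n) * kothe_seminorm ?b (Suc k) \<theta>"
    unfolding kothe_seminorm_def
    using suminf_split_initial_segment[OF kothe_space_summable[OF \<theta>], of "Suc k" n]
      sum_nonneg[of "{..<n}" "\<lambda>j. norm (\<theta> j) * ?b j (Suc k)"]
    by (intro mult_left_mono) (simp_all add: power_series_matrix_def)
  finally show "kothe_seminorm ?b k (hankel_column \<theta> n) \<le>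
      exp (- \<beta> n) * kothe_seminorm ?b (Suc k) \<theta>" .
qed

theorem proposition3p7:
  fixes a :: "nat \<Rightarrow> nat \<Rightarrow> real"
    and \<beta> :: "nat \<Rightarrow> real"
    and \<theta> :: "nat \<Rightarrow> 'a::{real_normed_field, heine_borel}"
  assumes "kothe_matrix a"
    and "\<And>n. 0 \<le> \<beta> n"
    and "incseq \<beta>"
    and "filterlim \<beta> at_top sequentially"
    and "\<theta> \<in> kothe_space (power_series_matrix \<beta>)"
    and "\<exists>m. \<forall>k. \<exists>C>0. \<forall>n. exp (- real (Suc k) * \<beta> n) \<le> C * a n m"
  shows "hankel_exists a (power_series_matrix \<beta>) \<theta> \<and>
         compact_linear_map (kothe_topology a) (kothe_topology (power_series_matrix \<beta>))
           (hankel_operator (power_series_matrix \<beta>) \<theta>)"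
proof -
  let ?b = "power_series_matrix \<beta>"
  note a = assms(1)
  have b: "kothe_matrix ?b"
    by (rule kothe_matrix_power_series_matrix) (rule assms(2))
  have col: "hankel_column \<theta> n \<in> kothe_space ?b" for n
    by (rule hankel_column_in_power_series_space) (use assms in auto)
  \<comment> \<open>At \<open>k = 0\<close> the exponent in the hypothesis is
    \<open>- \<beta> n\<close>, which matches the decay of the columns.\<close>
  obtain m C where C: "0 < C" "\<And>n. exp (- \<beta> n) \<le> C * a n m"
    using assms(6) by (metis mult_1 mult_minus_left of_nat_1 One_nat_def)
  \<comment> \<open>The seminorm of \<open>\<theta>\<close> is absorbed into the constant, so the
    same \<open>m\<close> serves every \<open>k\<close>.\<close>
  have dom: "\<exists>C\<ge>0. \<forall>n. kothe_seminorm ?b k (hankel_column \<theta> n) \<le> C * a n m" for k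
  proof -
    let ?q = "kothe_seminorm ?b (Suc k) \<theta>"
    have q: "0 \<le> ?q"
      by (rule kothe_seminorm_nonneg[OF b assms(5)])
    have "kothe_seminorm ?b k (hankel_column \<theta> n) \<le> C * ?q * a n m" for n
    proof -
      have "kothe_seminorm ?b k (hankel_column \<theta> n) \<le> exp (- \<beta> n) * ?q"
        by (rule kothe_seminorm_hankel_column_le) (use assms in auto)
      also have "\<dots> \<le> C * a n m * ?q"
        by (rule mult_right_mono[OF C(2) q])
      finally show ?thesis
        by (simp add: ac_simps)
    qed
    then show ?thesis
      using C(1) q by (intro exI[of _ "C * ?q"]) simp
  qed
  \<comment> \<open>This one neighbourhood of zero has an image bounded in every seminorm, again
    because \<open>m\<close> is independent of \<open>k\<close>.\<close>
  let ?U = "kothe_ball a m 0 1 :: (nat \<Rightarrow> 'a) set"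
  have lin: "linear_between (kothe_space a) (kothe_space ?b) (hankel_operator ?b \<theta>)"
    by (rule linear_between_hankel_operator[OF a b col dom])
  have "precompact_in (kothe_topology ?b) (hankel_operator ?b \<theta> ` ?U)"
  proof (rule precompact_in_power_series_space[OF assms(2-4)])
    show "hankel_operator ?b \<theta> ` ?U \<subseteq> kothe_space ?b"
      using lin by (auto simp: linear_between_def kothe_ball_def)
    fix k
    obtain C where C: "0 \<le> C" "\<And>n. kothe_seminorm ?b k (hankel_column \<theta> n) \<le> C * a n m"
      using dom by blast
    have "kothe_seminorm ?b k (hankel_operator ?b \<theta> x) \<le> C" if "x \<in> ?U" for x
    proof -
      have x: "x \<in> kothe_space a" "kothe_seminorm a m x \<le> 1"
        using that by (auto simp: kothe_ball_def)
      have "kothe_seminorm ?b k (hankel_operator ?b \<theta> x) \<le> C * kothe_seminorm a m x"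
        unfolding hankel_operator_eq[OF a b col dom x(1)]
        by (rule kothe_seminorm_hankel_image_le[OF a b col dom x(1) C(2)])
      also have "\<dots> \<le> C * 1"
        by (rule mult_left_mono[OF x(2) C(1)])
      finally show ?thesis
        by simp
    qed
    then show "\<exists>M. \<forall>y\<in>hankel_operator ?b \<theta> ` ?U. kothe_seminorm ?b k y \<le> M"
      by blast
  qed
  moreover have "openin (kothe_topology a) ?U" "0 \<in> ?U"
    by (simp_all add: openin_kothe_ball centre_in_kothe_ball)
  ultimately have "compact_linear_map (kothe_topology a) (kothe_topology ?b) (hankel_operator ?b \<theta>)"
    unfolding compact_linear_map_def using lin by auto
  moreover have "hankel_exists a ?b \<theta>"
    unfolding hankel_exists_def using col limitin_hankel_partial_sum[OF a b col dom] by blast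
  ultimately show ?thesis
    by blast
qed

end
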